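(* Let $F$ be a CNF formula over $n\ge2$ Boolean variables with set of satisfying assignments $S=S(F)\subseteq\{0,1\}^n$; for each integer $i\ge0$ fix an $i$-uniform distribution $\mathcal{D}_i$ on subsets of $\{0,1\}^n$. For an integer $i\ge0$ and positive integer $z$, let $A1(i,z)$ denote one run (with fresh independent randomness) of the following procedure: set $Z=0$, $j=0$; while $j<z$ and $Z<2z$: sample $R_j\sim\mathcal{D}_i$, set $Z\leftarrow Z+\min\{4,|S\cap R_j|\}$, $j\leftarrow j+1$; return ``Yes'' if $Z/z\ge2$ and ``Don't know'' otherwise. Let $\theta>0$ and let $\ell$ be an integer with $0\le\ell\le\log_2|S|$. Consider the procedure: (1) $j\leftarrow0$; while $A1(\ell+2^j,1)=$``Yes'', set $j\leftarrow j+1$. (2) If $j=0$, return $\ell$. (3) $h\leftarrow\ell+2^j-1$, $i\leftarrow\ell+2^{j-1}$. (4) While $i<h$: $m\leftarrow i+\lceil(h-i)/2\rceil$; if $A1(m,1)=$``Yes'' then $i\leftarrow m$, else $h\leftarrow m-1$. (5) $j\leftarrow1$; repeat $\{i\leftarrow i-2^j;\ j\leftarrow j+1\}$ until $i\le\ell$ or $A1\big(i,\lceil 8\ln(\lceil\log_2 n\rceil/\theta)\rceil\big)=$``Yes''. (6) Return $\max\{\ell,i\}$. Then the output of this procedure exceeds $\log_2|S|$ with probability at most $\theta$.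
   Context: A distribution $\mathcal{D}$ on subsets of $\{0,1\}^n$ is $i$-uniform if, for $R\sim\mathcal{D}$, $\Pr[\sigma\in R]=2^{-i}$ for every $\sigma\in\{0,1\}^n$. *)

theory Defs
  imports "HOL-Probability.SPMF"
begin

section \<open>CNF formulas\<close>

datatype literal = Pos nat | Neg nat

type_synonym clause = "literal list"
type_synonym cnf = "clause list"

fun var :: "literal \<Rightarrow> nat" where
  "var (Pos v) = v"
| "var (Neg v) = v"

fun sat_literal :: "bool list \<Rightarrow> literal \<Rightarrow> bool" where
  "sat_literal \<sigma> (Pos v) = \<sigma> ! v"
| "sat_literal \<sigma> (Neg v) = (\<not> \<sigma> ! v)"

definition sat_cnf :: "bool list \<Rightarrow> cnf \<Rightarrow> bool" where
  "sat_cnf \<sigma> F \<longleftrightarrow> (\<forall>C \<in> set F. \<exists>L \<in> set C. sat_literal \<sigma> L)"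

text \<open>The variables are numbered \<open>0, \<dots>, n - 1\<close>; not all of them need to occur in the formula.\<close>

definition cnf_over :: "nat \<Rightarrow> cnf \<Rightarrow> bool" where
  "cnf_over n F \<longleftrightarrow> (\<forall>C \<in> set F. \<forall>L \<in> set C. var L < n)"

definition cube :: "nat \<Rightarrow> bool list set" where
  "cube n = {\<sigma>. length \<sigma> = n}"

definition sat_set :: "nat \<Rightarrow> cnf \<Rightarrow> bool list set" where
  "sat_set n F = {\<sigma> \<in> cube n. sat_cnf \<sigma> F}"

section \<open>Uniform distributions on subsets of the cube\<close>

definition i_uniform :: "nat \<Rightarrow> int \<Rightarrow> bool list set pmf \<Rightarrow> bool" where
  "i_uniform n i D \<longleftrightarrow>
     set_pmf D \<subseteq> Pow (cube n) \<and>
     (\<forall>\<sigma> \<in> cube n. measure_pmf.prob D {R. \<sigma> \<in> R} = 2 powi (- i))"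

section \<open>The randomized procedures\<close>

text \<open>
  A while loop whose guard may itself be random; every evaluation of guard and body
  uses fresh randomness. Divergence shows up as missing probability mass.
\<close>

partial_function (spmf) while_spmf ::
  "('s \<Rightarrow> bool spmf) \<Rightarrow> ('s \<Rightarrow> 's spmf) \<Rightarrow> 's \<Rightarrow> 's spmf" where
  "while_spmf guard body s =
     bind_spmf (guard s) (\<lambda>b.
       if b then bind_spmf (body s) (while_spmf guard body) else return_spmf s)"

text \<open>The result \<open>True\<close> stands for ``Yes'' and \<open>False\<close> for ``Don't know''.\<close>

definition A1 :: "bool list set \<Rightarrow> (int \<Rightarrow> bool list set pmf) \<Rightarrow> int \<Rightarrow> nat \<Rightarrow> bool spmf" where
  "A1 S D i z =
     bind_spmf
       (while_spmf
         (\<lambda>(Z, j). return_spmf (j < z \<and> Z < 2 * z))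
         (\<lambda>(Z, j). bind_spmf (spmf_of_pmf (D i)) (\<lambda>R.
            return_spmf (Z + min 4 (card (S \<inter> R)), j + 1)))
         (0 :: nat, 0 :: nat))
       (\<lambda>(Z, j). return_spmf (real Z / real z \<ge> 2))"

definition doubling_search ::
  "bool list set \<Rightarrow> (int \<Rightarrow> bool list set pmf) \<Rightarrow> int \<Rightarrow> nat spmf" where
  "doubling_search S D l =
     while_spmf (\<lambda>j. A1 S D (l + 2 ^ j) 1) (\<lambda>j. return_spmf (j + 1)) 0"

definition binary_search ::
  "bool list set \<Rightarrow> (int \<Rightarrow> bool list set pmf) \<Rightarrow> int \<Rightarrow> int \<Rightarrow> int spmf" where
  "binary_search S D i h =
     map_spmf fst
       (while_spmf
         (\<lambda>(i, h). return_spmf (i < h))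
         (\<lambda>(i, h).
            let m = i + \<lceil>real_of_int (h - i) / 2\<rceil>
            in bind_spmf (A1 S D m 1) (\<lambda>yes.
                 return_spmf (if yes then (m, h) else (i, m - 1))))
         (i, h))"

text \<open>
  The body is executed once before the first test, as in a repeat-until loop, and the test
  calls \<^const>\<open>A1\<close> only if \<open>i > l\<close>. The conversion \<open>nat\<close> truncates only if
  \<open>\<theta> \<ge> \<lceil>log 2 n\<rceil>\<close>; the number of samples is then \<open>0\<close>.
\<close>

definition reverse_search ::
  "nat \<Rightarrow> bool list set \<Rightarrow> (int \<Rightarrow> bool list set pmf) \<Rightarrow> real \<Rightarrow> int \<Rightarrow> int \<Rightarrow> int spmf" where
  "reverse_search n S D \<theta> l i0 =
     (let z = nat \<lceil>8 * ln (real_of_int \<lceil>log 2 (real n)\<rceil> / \<theta>)\<rceil>;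
          body = (\<lambda>(i, j). return_spmf (i - 2 ^ j, j + 1))
      in map_spmf fst
           (bind_spmf (body (i0, 1 :: nat))
             (while_spmf
               (\<lambda>(i, j). if i \<le> l then return_spmf False else map_spmf Not (A1 S D i z))
               body)))"

definition lower_bound ::
  "nat \<Rightarrow> bool list set \<Rightarrow> (int \<Rightarrow> bool list set pmf) \<Rightarrow> real \<Rightarrow> int \<Rightarrow> int spmf" where
  "lower_bound n S D \<theta> l =
     bind_spmf (doubling_search S D l) (\<lambda>j.
       if j = 0 then return_spmf l
       else
         bind_spmf (binary_search S D (l + 2 ^ (j - 1)) (l + 2 ^ j - 1)) (\<lambda>i.
         bind_spmf (reverse_search n S D \<theta> l i) (\<lambda>i'.
         return_spmf (max l i'))))"

end

theory Submission
  imports Defs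
begin

text \<open>
  Write \<open>s = log 2 (card S)\<close> and \<open>L = \<lceil>log 2 n\<rceil>\<close>. The output exceeds \<open>s\<close> only if some test of
  the reverse search says ``Yes'' at a position above \<open>s\<close>, and a Chernoff bound shows that each
  such test does so with probability at most \<open>\<theta> / L\<close>. If the doubling search stops at \<open>j\<close>, there
  are at most \<open>j - 1\<close> tests above \<open>l\<close>. The number \<open>j\<close> itself is unbounded, but for \<open>j \<ge> L\<close> we
  have \<open>l + 2 ^ j \<ge> n \<ge> s\<close>, so by Markov's inequality the doubling search continues with
  probability at most \<open>1/2\<close>. Hence the expected number of such tests is at most \<open>L\<close>, and the
  union bound gives \<open>\<theta>\<close>. Every loop is handled by an invariant \<open>I\<close> with values in \<open>[0, \<infinity>]\<close> that
  does not increase in expectation and dominates the postcondition on exit.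
\<close>

section \<open>Integration over subprobability measures and a rule for loops\<close>

lemma nn_integral_bind_spmf:
  "(\<integral>\<^sup>+ y. f y \<partial>measure_spmf (bind_spmf p g)) =
     (\<integral>\<^sup>+ x. \<integral>\<^sup>+ y. f y \<partial>measure_spmf (g x) \<partial>measure_spmf p)"
  by (simp add: measure_spmf_bind o_def nn_integral_bind[where B="count_space UNIV"] space_subprob_algebra subprob_space_measure_spmf)

lemma nn_integral_return_spmf:
  "(\<integral>\<^sup>+ y. f y \<partial>measure_spmf (return_spmf x)) = f x"
  by (simp add: measure_spmf_return_spmf nn_integral_return)

lemma nn_integral_map_spmf:
  "(\<integral>\<^sup>+ y. f y \<partial>measure_spmf (map_spmf g p)) = (\<integral>\<^sup>+ x. f (g x) \<partial>measure_spmf p)"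
  by (simp add: measure_map_spmf_conv_distr nn_integral_distr)

text \<open>Monotone convergence along a chain; it makes the bound in \<open>while_spmf_le\<close>
  admissible for fixpoint induction.\<close>

lemma nn_integral_lub_spmf_le:
  assumes "Complete_Partial_Order.chain (ord_spmf (=)) Y" "Y \<noteq> {}"
    and "\<And>p. p \<in> Y \<Longrightarrow> (\<integral>\<^sup>+ x. f x \<partial>measure_spmf p) \<le> B"
  shows "(\<integral>\<^sup>+ x. f x \<partial>measure_spmf (lub_spmf Y)) \<le> B"
proof -
  \<comment> \<open>Interchanging integral and supremum over an arbitrary chain uses a countable
    space, hence the restriction to the support of the limit.\<close>
  let ?M = "count_space (set_spmf (lub_spmf Y))"
  have "(\<integral>\<^sup>+ x. f x \<partial>measure_spmf (lub_spmf Y)) =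
     (\<integral>\<^sup>+ x. (SUP p\<in>Y. ennreal (spmf p x) * f x) \<partial>?M)"
    using assms by (simp add: nn_integral_measure_spmf' ennreal_spmf_lub_spmf SUP_mult_right_ennreal)
  also have "\<dots> = (SUP p\<in>Y. \<integral>\<^sup>+ x. ennreal (spmf p x) * f x \<partial>?M)"
  proof (rule nn_integral_monotone_convergence_SUP_countable)
    show "Complete_Partial_Order.chain (\<le>) ((\<lambda>i x. ennreal (spmf i x) * f x) ` Y)"
      using assms(1) by (rule chain_imageI) (auto simp: le_fun_def intro!: mult_right_mono ennreal_leI dest: ord_spmf_eq_leD)
  qed (simp_all add: assms)
  also have "\<dots> \<le> B"
  proof (rule SUP_least)
    fix p assume p: "p \<in> Y"
    have "(\<integral>\<^sup>+ x. ennreal (spmf p x) * f x \<partial>?M) \<le> (\<integral>\<^sup>+ x. ennreal (spmf p x) * f x \<partial>count_space UNIV)"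
      by (simp add: nn_integral_count_space_indicator) (auto intro!: nn_integral_mono split: split_indicator)
    with assms(3)[OF p] show "(\<integral>\<^sup>+ x. ennreal (spmf p x) * f x \<partial>?M) \<le> B"
      by (simp add: nn_integral_measure_spmf)
  qed
  finally show ?thesis .
qed

text \<open>Every finite unrolling of the loop satisfies the bound, hence so does the limit.
  Diverging runs only lose mass, so termination is not at issue.\<close>

lemma while_spmf_le:
  assumes step: "\<And>s. (\<integral>\<^sup>+ b. (if b then \<integral>\<^sup>+ t. I t \<partial>measure_spmf (body s) else f s) \<partial>measure_spmf (guard s)) \<le> I s"
  shows "(\<integral>\<^sup>+ x. f x \<partial>measure_spmf (while_spmf guard body s)) \<le> I s"
proof (induction arbitrary: s rule: while_spmf.fixp_induct)
  case 1
  show ?case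
  proof (rule ccpo.admissibleI, intro allI)
    fix A s
    assume A: "Complete_Partial_Order.chain spmf.le_fun A" "A \<noteq> {}"
      "\<forall>w\<in>A. \<forall>s. (\<integral>\<^sup>+ x. f x \<partial>measure_spmf (curry (curry w) guard body s)) \<le> I s"
    show "(\<integral>\<^sup>+ x. f x \<partial>measure_spmf (curry (curry (spmf.lub_fun A)) guard body s)) \<le> I s"
      unfolding fun_lub_def curry_def
    proof (rule nn_integral_lub_spmf_le)
      show "Complete_Partial_Order.chain (ord_spmf (=)) {y. \<exists>w\<in>A. y = w ((guard, body), s)}"
        using A(1) unfolding chain_def fun_ord_def by blast
    qed (use A in auto)
  qed
next
  case 2
  then show ?case by simp
next
  case (3 w)
  have "(\<integral>\<^sup>+ x. f x \<partial>measure_spmf (if b then body s \<bind> w guard body else return_spmf s)) \<le>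
    (if b then \<integral>\<^sup>+ t. I t \<partial>measure_spmf (body s) else f s)" for b
    by (auto simp: nn_integral_bind_spmf nn_integral_return_spmf intro!: nn_integral_mono 3)
  then have "(\<integral>\<^sup>+ b. \<integral>\<^sup>+ x. f x \<partial>measure_spmf (if b then body s \<bind> w guard body else return_spmf s) \<partial>measure_spmf (guard s)) \<le> I s"
    by (intro order_trans[OF nn_integral_mono step])
  then show ?case
    by (subst nn_integral_bind_spmf)
qed

lemma nn_integral_bool_spmf:
  "(\<integral>\<^sup>+ b. f b \<partial>measure_spmf p) = ennreal (spmf p True) * f True + ennreal (spmf p False) * f False"
  by (simp add: nn_integral_measure_spmf nn_integral_count_space_finite UNIV_bool add.commute)

lemma spmf_bool_sum_le_1: "spmf p True + spmf p False \<le> 1"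
proof -
  have "ennreal (spmf p True + spmf p False) = (\<integral>\<^sup>+ b. 1 \<partial>measure_spmf p)"
    by (simp only: nn_integral_bool_spmf) simp
  also have "\<dots> \<le> 1"
    by (simp add: measure_spmf.emeasure_space_le_1[of p, simplified])
  finally show ?thesis
    by (simp del: ennreal_plus)
qed

text \<open>The loop rule for \<open>A1\<close>: \<open>I Z j\<close> is a potential that bounds the
  probability of a final "Yes" from the state \<open>(Z, j)\<close>.\<close>

lemma spmf_A1_True_le:
  fixes I :: "nat \<Rightarrow> nat \<Rightarrow> ennreal"
  assumes step: "\<And>Z j. j < z \<Longrightarrow> (\<integral>\<^sup>+ R. I (Z + min 4 (card (S \<inter> R))) (j + 1) \<partial>measure_pmf (D i)) \<le> I Z j"
    and yes: "\<And>Z j. 0 < z \<Longrightarrow> 2 * z \<le> Z \<Longrightarrow> 1 \<le> I Z j"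
  shows "ennreal (spmf (A1 S D i z) True) \<le> I 0 0"
proof -
  have yes': "of_bool (2 \<le> real Z / real z) \<le> I Z j" for Z j
    \<comment> \<open>For \<open>z = 0\<close> the quotient is \<open>0\<close> by convention, so
      the answer is "Don't know".\<close>
    using yes[of Z j] by (cases "z = 0") (auto simp: field_simps)
  have "ennreal (spmf (A1 S D i z) True) = (\<integral>\<^sup>+ b. of_bool b \<partial>measure_spmf (A1 S D i z))"
    by (simp add: nn_integral_bool_spmf)
  also have "\<dots> \<le> (case (0, 0) of (Z, j) \<Rightarrow> I Z j)"
    unfolding A1_def nn_integral_bind_spmf
    by (rule while_spmf_le)
      (use step yes' in \<open>auto simp: nn_integral_bind_spmf nn_integral_return_spmf simp del: bind_spmf_of_pmf\<close>)
  finally show ?thesis by simp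
qed

lemma finite_cube: "finite (cube n)" and card_cube: "card (cube n) = 2 ^ n"
  using finite_lists_length_eq[of "UNIV :: bool set" n] card_lists_length_eq[of "UNIV :: bool set" n]
  by (auto simp: cube_def)

text \<open>Linearity of expectation over the membership indicators of the elements of
  \<open>S\<close>.\<close>

lemma nn_integral_card_Int:
  assumes "i_uniform n i D" "S \<subseteq> cube n"
  shows "(\<integral>\<^sup>+ R. ennreal (real (card (S \<inter> R))) \<partial>measure_pmf D) = ennreal (real (card S) * 2 powi (- i))"
proof -
  have fin: "finite S"
    using assms(2) finite_cube by (rule finite_subset)
  have "(\<integral>\<^sup>+ R. ennreal (real (card (S \<inter> R))) \<partial>measure_pmf D)
      = (\<integral>\<^sup>+ R. (\<Sum>\<sigma>\<in>S. indicator {R. \<sigma> \<in> R} R) \<partial>measure_pmf D)"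
    using fin by (intro nn_integral_cong)
      (simp add: indicator_def sum.If_cases Int_def conj_commute flip: ennreal_of_nat_eq_real_of_nat)
  also have "\<dots> = (\<Sum>\<sigma>\<in>S. emeasure (measure_pmf D) {R. \<sigma> \<in> R})"
    by (simp add: nn_integral_sum)
  also have "\<dots> = (\<Sum>\<sigma>\<in>S. ennreal (2 powi (- i)))"
    using assms by (intro sum.cong) (auto simp: i_uniform_def measure_pmf.emeasure_eq_measure)
  also have "\<dots> = ennreal (real (card S) * 2 powi (- i))"
    by (simp add: ennreal_mult ennreal_of_nat_eq_real_of_nat)
  finally show ?thesis .
qed

section \<open>False positives of \<open>A1\<close> at levels at or above
  \<open>log 2 (card S)\<close>\<close>

context
  fixes n :: nat and S :: "bool list set" and D :: "int \<Rightarrow> bool list set pmf" and i :: int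
  assumes unif: "i_uniform n i (D i)" and S: "S \<subseteq> cube n" "S \<noteq> {}"
    and i_ge: "log 2 (real (card S)) \<le> real_of_int i"
begin

lemma nn_integral_card_Int_le_1:
  "(\<integral>\<^sup>+ R. ennreal (real (card (S \<inter> R))) \<partial>measure_pmf (D i)) \<le> 1"
proof -
  have "finite S"
    using S(1) finite_cube by (rule finite_subset)
  then have "real (card S) \<le> 2 powr real_of_int i"
    using i_ge S(2) by (simp add: log_le_iff card_gt_0_iff)
  then have "real (card S) * 2 powi (- i) \<le> 1"
    by (simp add: powr_real_of_int' power_int_minus field_simps)
  then show ?thesis
    by (simp add: nn_integral_card_Int[OF unif S(1)])
qed

text \<open>The weight is the Markov bound for the current sum plus the expected future contributions.\<close>

lemma spmf_A1_True_le_half: "spmf (A1 S D i z) True \<le> 1 / 2"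
proof -
  define I where "I Z j = ennreal (real (Z + (z - j)) / real (2 * z))" for Z j
  have "ennreal (spmf (A1 S D i z) True) \<le> I 0 0"
  proof (rule spmf_A1_True_le[where I=I])
    fix Z j assume j: "j < z"
    let ?c = "real (2 * z)"
    \<comment> \<open>Dropping the cap by \<open>min 4 x \<le> x\<close> leaves a bound affine in
      the sample size.\<close>
    have "(\<integral>\<^sup>+ R. I (Z + min 4 (card (S \<inter> R))) (j + 1) \<partial>measure_pmf (D i))
        \<le> (\<integral>\<^sup>+ R. ennreal (real (Z + (z - (j + 1))) / ?c) + ennreal (1 / ?c) * ennreal (real (card (S \<inter> R))) \<partial>measure_pmf (D i))"
      by (intro nn_integral_mono)
        (auto simp: I_def field_simps add_divide_distrib simp flip: ennreal_plus ennreal_mult intro!: ennreal_leI divide_right_mono)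
    also have "\<dots> = ennreal (real (Z + (z - (j + 1))) / ?c) + ennreal (1 / ?c) * (\<integral>\<^sup>+ R. ennreal (real (card (S \<inter> R))) \<partial>measure_pmf (D i))"
      by (simp add: nn_integral_add nn_integral_cmult)
    also have "\<dots> \<le> ennreal (real (Z + (z - (j + 1))) / ?c) + ennreal (1 / ?c) * 1"
      by (intro add_left_mono mult_left_mono nn_integral_card_Int_le_1) auto
    also have "\<dots> = I Z j"
      using j by (simp add: I_def field_simps of_nat_diff flip: ennreal_plus)
    finally show "(\<integral>\<^sup>+ R. I (Z + min 4 (card (S \<inter> R))) (j + 1) \<partial>measure_pmf (D i)) \<le> I Z j" .
  next
    fix Z j assume "0 < z" "2 * z \<le> Z"
    then show "1 \<le> I Z j" by (simp add: I_def)
  qed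
  also have "I 0 0 \<le> ennreal (1 / 2)"
    unfolding I_def by (rule ennreal_leI) (cases "z = 0"; simp)
  finally show ?thesis
    by (subst (asm) ennreal_le_iff) auto
qed

text \<open>
  Chernoff bound with exponential weight \<open>(4/3)\<^sup>Z\<close>: since \<open>(4/3)\<^sup>x \<le> 1 + 175/324 \<sqdot> x\<close>
  for \<open>x \<in> {0, \<dots>, 4}\<close>, each sample multiplies the expected weight by at most
  \<open>1 + 175/324 = 499/324\<close>, while ``Yes'' requires the weight \<open>(16/9)\<^sup>z\<close>.
\<close>

lemma spmf_A1_True_le_power: "spmf (A1 S D i z) True \<le> (499 / 576) ^ z"
proof -
  \<comment> \<open>The factor \<open>(9 / 16) ^ z\<close> makes the weight at least
    \<open>1\<close> once \<open>2 * z \<le> Z\<close>; the final rate is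
    \<open>499 / 324 * 9 / 16 = 499 / 576\<close>.\<close>
  define I where "I Z j = ennreal ((4 / 3) ^ Z * (499 / 324) ^ (z - j) * (9 / 16) ^ z)" for Z j
  have "ennreal (spmf (A1 S D i z) True) \<le> I 0 0"
  proof (rule spmf_A1_True_le[where I=I])
    fix Z j assume j: "j < z"
    define c :: real where "c = (4 / 3) ^ Z * (499 / 324) ^ (z - (j + 1)) * (9 / 16) ^ z"
    have c: "c \<ge> 0" by (simp add: c_def)
    \<comment> \<open>The right side is the chord of a convex function through \<open>x = 0\<close>
      and \<open>x = 4\<close>; beyond \<open>4\<close> the cap freezes the left side.\<close>
    have le: "(4 / 3 :: real) ^ min 4 x \<le> 1 + 175 / 324 * real x" for x :: nat
    proof -
      consider "x = 0" | "x = 1" | "x = 2" | "x = 3" | "x \<ge> 4" by linarith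
      then show ?thesis by cases (auto simp: power_numeral_reduce min_def)
    qed
    have "(\<integral>\<^sup>+ R. I (Z + min 4 (card (S \<inter> R))) (j + 1) \<partial>measure_pmf (D i))
        \<le> (\<integral>\<^sup>+ R. ennreal c + ennreal (c * (175 / 324)) * ennreal (real (card (S \<inter> R))) \<partial>measure_pmf (D i))"
    proof (intro nn_integral_mono)
      fix R
      have "(4 / 3) ^ (Z + min 4 (card (S \<inter> R))) * (499 / 324) ^ (z - (j + 1)) * (9 / 16) ^ z
          = c * (4 / 3) ^ min 4 (card (S \<inter> R))"
        by (simp add: c_def power_add)
      also have "\<dots> \<le> c * (1 + 175 / 324 * real (card (S \<inter> R)))"
        by (intro mult_left_mono le c)
      finally show "I (Z + min 4 (card (S \<inter> R))) (j + 1) \<le> ennreal c + ennreal (c * (175 / 324)) * ennreal (real (card (S \<inter> R)))"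
        using c by (simp add: I_def algebra_simps flip: ennreal_plus ennreal_mult)
    qed
    also have "\<dots> = ennreal c + ennreal (c * (175 / 324)) * (\<integral>\<^sup>+ R. ennreal (real (card (S \<inter> R))) \<partial>measure_pmf (D i))"
      by (simp add: nn_integral_add nn_integral_cmult)
    also have "\<dots> \<le> ennreal c + ennreal (c * (175 / 324)) * 1"
      by (intro add_left_mono mult_left_mono nn_integral_card_Int_le_1) auto
    also have "\<dots> = ennreal (c * (499 / 324))"
      using c by (simp flip: ennreal_plus)
    also have "c * (499 / 324) = (4 / 3) ^ Z * (499 / 324) ^ Suc (z - (j + 1)) * (9 / 16) ^ z"
      by (simp add: c_def)
    also have "Suc (z - (j + 1)) = z - j"
      using j by simp
    finally show "(\<integral>\<^sup>+ R. I (Z + min 4 (card (S \<inter> R))) (j + 1) \<partial>measure_pmf (D i)) \<le> I Z j"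
      by (simp add: I_def)
  next
    fix Z j assume "2 * z \<le> Z"
    have "(1 :: real) = (4 / 3) ^ (2 * z) * 1 * (9 / 16) ^ z"
      by (simp add: power_mult power2_eq_square flip: power_mult_distrib)
    also have "\<dots> \<le> (4 / 3) ^ Z * (499 / 324) ^ (z - j) * (9 / 16) ^ z"
      using \<open>2 * z \<le> Z\<close> by (intro mult_right_mono mult_mono power_increasing one_le_power) auto
    finally show "1 \<le> I Z j"
      by (simp add: I_def)
  qed
  also have "I 0 0 = ennreal ((499 / 576) ^ z)"
    by (simp add: I_def flip: power_mult_distrib)
  finally show ?thesis by simp
qed

text \<open>The factor \<open>8\<close> suffices because
  \<open>(576 / 499) ^ 8 \<ge> 3 \<ge> exp 1\<close>: each sample contributes a factor of at most
  \<open>exp (- 1 / 8)\<close>.\<close>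

lemma spmf_A1_True_le_ratio:
  assumes "L > 0" "\<theta> > 0"
  shows "spmf (A1 S D i (nat \<lceil>8 * ln (L / \<theta>)\<rceil>)) True \<le> \<theta> / L"
proof -
  let ?z = "nat \<lceil>8 * ln (L / \<theta>)\<rceil>"
  have "exp (1 :: real) \<le> (576 / 499) ^ 8"
    by (rule order_trans[OF exp_le]) (simp add: power_numeral_reduce)
  then have "1 \<le> ln ((576 / 499 :: real) ^ 8)"
    by (subst ln_ge_iff) auto
  then have ln: "ln (499 / 576 :: real) \<le> - 1 / 8"
    by (simp add: ln_realpow ln_div)
  have "(499 / 576 :: real) ^ ?z = exp (real ?z * ln (499 / 576))"
    by (simp add: exp_of_nat_mult)
  also have "\<dots> \<le> exp (real ?z * (- 1 / 8))"
    using ln by (intro exp_le_cancel_iff[THEN iffD2] mult_left_mono) auto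
  \<comment> \<open>This covers a negative ceiling too: then \<open>?z = 0\<close>, and the right
    side is at least \<open>1\<close>.\<close>
  also have "\<dots> \<le> exp (- ln (L / \<theta>))"
    by (simp, linarith)
  also have "\<dots> = \<theta> / L"
    using assms by (simp add: exp_minus)
  finally show ?thesis
    using spmf_A1_True_le_power by (rule order_trans[rotated])
qed

end

section \<open>The three search phases\<close>

text \<open>The invariant is \<open>C * max j L\<close>. Below \<open>L\<close> a step leaves it
  constant; from \<open>L\<close> on, the rise by \<open>1\<close> on "Yes" is balanced by the exit
  value \<open>j - 1\<close>, since "Yes" has probability at most \<open>1 / 2\<close>.\<close>

lemma doubling_search_le:
  fixes L :: nat and C :: real
  assumes L: "L \<ge> 1" and C: "C \<ge> 0"
    and half: "\<And>j. L \<le> j \<Longrightarrow> spmf (A1 S D (l + 2 ^ j) 1) True \<le> 1 / 2"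
  shows "(\<integral>\<^sup>+ j. ennreal (C * real (j - 1)) \<partial>measure_spmf (doubling_search S D l)) \<le> ennreal (C * real L)"
proof -
  have "(\<integral>\<^sup>+ j. ennreal (C * real (j - 1)) \<partial>measure_spmf (doubling_search S D l)) \<le> ennreal (C * real (max 0 L))"
    unfolding doubling_search_def
  proof (rule while_spmf_le)
    fix j
    define p where "p = spmf (A1 S D (l + 2 ^ j) 1) True"
    define q where "q = spmf (A1 S D (l + 2 ^ j) 1) False"
    have pq: "0 \<le> p" "0 \<le> q" "p + q \<le> 1"
      by (auto simp: p_def q_def spmf_bool_sum_le_1)
    have "p * real (max (j + 1) L) + q * real (j - 1) \<le> real (max j L)"
    proof (cases "j < L")
      case True
      have "p * real (max (j + 1) L) + q * real (j - 1) \<le> p * real L + q * real L"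
        using True pq by (intro add_mono mult_left_mono) auto
      also have "\<dots> \<le> 1 * real L"
        unfolding distrib_right[symmetric] using pq by (intro mult_right_mono) auto
      finally show ?thesis using True by simp
    next
      case False
      then have "p \<le> 1 / 2"
        using half by (simp add: p_def)
      \<comment> \<open>Here \<open>j \<ge> L \<ge> 1\<close>, so the truncated \<open>j - 1\<close>
        is exact.\<close>
      have "p * real (max (j + 1) L) + q * real (j - 1) = (p + q) * real (j - 1) + 2 * p"
        using False L by (simp add: of_nat_diff algebra_simps)
      also have "\<dots> \<le> 1 * real (j - 1) + 1"
        using pq \<open>p \<le> 1 / 2\<close> by (intro add_mono mult_right_mono) auto
      finally show ?thesis using False L by simp
    qed
    then have "C * (p * real (max (j + 1) L) + q * real (j - 1)) \<le> C * real (max j L)"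
      using C by (rule mult_left_mono)
    then show "(\<integral>\<^sup>+ b. (if b then \<integral>\<^sup>+ t. ennreal (C * real (max t L)) \<partial>measure_spmf (return_spmf (j + 1))
        else ennreal (C * real (j - 1))) \<partial>measure_spmf (A1 S D (l + 2 ^ j) 1)) \<le> ennreal (C * real (max j L))"
      using C pq unfolding nn_integral_bool_spmf p_def[symmetric] q_def[symmetric]
      by (simp add: nn_integral_return_spmf algebra_simps flip: ennreal_plus ennreal_mult)
  qed
  then show ?thesis by simp
qed

text \<open>Whatever the tests answer, both ends of the interval stay at most \<open>h0\<close>;
  nothing else about the result is used later.\<close>

lemma binary_search_le:
  assumes "\<And>i. i \<le> h0 \<Longrightarrow> f i \<le> B" and "i0 \<le> h0"
  shows "(\<integral>\<^sup>+ i. f i \<partial>measure_spmf (binary_search S D i0 h0)) \<le> B"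
proof -
  \<comment> \<open>The value \<open>top\<close> outside the range turns a Boolean invariant into a
    weight.\<close>
  define I where "I = (\<lambda>(i, h). if i \<le> h0 \<and> h \<le> h0 then B else top)"
  have "(\<integral>\<^sup>+ i. f i \<partial>measure_spmf (binary_search S D i0 h0)) \<le> I (i0, h0)"
    unfolding binary_search_def nn_integral_map_spmf
  proof (rule while_spmf_le)
    fix s :: "int \<times> int"
    obtain i h where s: "s = (i, h)" by (cases s)
    define m where "m = i + \<lceil>real_of_int (h - i) / 2\<rceil>"
    show "(\<integral>\<^sup>+ b. (if b then \<integral>\<^sup>+ t. I t \<partial>measure_spmf (case s of (i, h) \<Rightarrow> let m = i + \<lceil>real_of_int (h - i) / 2\<rceil> in
          A1 S D m 1 \<bind> (\<lambda>yes. return_spmf (if yes then (m, h) else (i, m - 1)))) else f (fst s))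
        \<partial>measure_spmf (case s of (i, h) \<Rightarrow> return_spmf (i < h))) \<le> I s"
    proof (cases "i \<le> h0 \<and> h \<le> h0")
      case inv: True
      show ?thesis
      proof (cases "i < h")
        case True
        then have "\<lceil>real_of_int (h - i) / 2\<rceil> \<le> h - i"
          by (subst ceiling_le_iff) simp
        then have "m \<le> h"
          by (simp add: m_def)
        then have "(\<integral>\<^sup>+ yes. I (if yes then (m, h) else (i, m - 1)) \<partial>measure_spmf (A1 S D m 1)) \<le> (\<integral>\<^sup>+ yes. B \<partial>measure_spmf (A1 S D m 1))"
          using inv by (intro nn_integral_mono) (auto simp: I_def)
        also have "\<dots> \<le> B * 1"
          by (simp only: nn_integral_const) (intro mult_left_mono measure_spmf.emeasure_space_le_1, simp)
        finally show ?thesis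
          unfolding s prod.case Let_def m_def[symmetric] nn_integral_bind_spmf nn_integral_return_spmf
          using True inv by (simp add: I_def)
      next
        case False
        then show ?thesis
          using inv assms by (simp add: s nn_integral_return_spmf I_def)
      qed
    qed (auto simp: I_def s)
  qed
  then show ?thesis
    using assms by (simp add: I_def)
qed

text \<open>
  The \<open>j\<close>-th test of the loop sees a position of at most \<open>l + 2 ^ J - 2 ^ (j + 1) + 1\<close>, so
  at most \<open>J - 1\<close> tests happen above \<open>l\<close>.
\<close>

lemma reverse_search_le:
  fixes C x :: real
  assumes C: "C \<ge> 0" and l: "real_of_int l \<le> x" and i0: "i0 \<le> l + 2 ^ J - 1"
    and yes: "\<And>i. x < real_of_int i \<Longrightarrow>
      spmf (A1 S D i (nat \<lceil>8 * ln (real_of_int \<lceil>log 2 (real n)\<rceil> / \<theta>)\<rceil>)) True \<le> C"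
  shows "(\<integral>\<^sup>+ i. of_bool (x < real_of_int (max l i)) \<partial>measure_spmf (reverse_search n S D \<theta> l i0))
    \<le> ennreal (C * real (J - 1))"
proof -
  define z where "z = nat \<lceil>8 * ln (real_of_int \<lceil>log 2 (real n)\<rceil> / \<theta>)\<rceil>"
  \<comment> \<open>The counter starts the loop at \<open>2\<close>, one ahead of the number of the
    coming test, so \<open>J + 1 - j\<close> tests above \<open>l\<close> may remain.\<close>
  define I where "I = (\<lambda>(i, j). if i \<le> l + 2 ^ J - 2 ^ j + 1 then ennreal (C * real (J + 1 - j)) else top)"
  let ?f = "\<lambda>i. of_bool (x < real_of_int (max l i)) :: ennreal"
  have "(\<integral>\<^sup>+ s. ?f (fst s) \<partial>measure_spmf (while_spmf
      (\<lambda>(i, j). if i \<le> l then return_spmf False else map_spmf Not (A1 S D i z))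
      (\<lambda>(i, j). return_spmf (i - 2 ^ j, j + 1)) (i0 - 2 ^ 1, 1 + 1))) \<le> I (i0 - 2 ^ 1, 1 + 1)"
  proof (rule while_spmf_le)
    fix s :: "int \<times> nat"
    obtain i j where s: "s = (i, j)" by (cases s)
    show "(\<integral>\<^sup>+ b. (if b then \<integral>\<^sup>+ t. I t \<partial>measure_spmf (case s of (i, j) \<Rightarrow> return_spmf (i - 2 ^ j, j + 1)) else ?f (fst s))
        \<partial>measure_spmf (case s of (i, j) \<Rightarrow> if i \<le> l then return_spmf False else map_spmf Not (A1 S D i z))) \<le> I s"
    proof (cases "i \<le> l + 2 ^ J - 2 ^ j + 1")
      case inv: True
      show ?thesis
      proof (cases "i \<le> l")
        case True
        then show ?thesis
          using l by (simp add: s nn_integral_return_spmf max_def)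
      next
        case False
        with inv have "(2 :: int) ^ j \<le> 2 ^ J"
          by linarith
        then have "j \<le> J"
          by simp
        define p where "p = spmf (A1 S D i z) True"
        define q where "q = spmf (A1 S D i z) False"
        have pq: "0 \<le> p" "0 \<le> q" "q \<le> 1"
          by (auto simp: p_def q_def pmf_le_1)
        \<comment> \<open>Union bound: a "Yes" at a position up to \<open>x\<close> is harmless, and
          one above \<open>x\<close> costs at most \<open>C\<close>.\<close>
        have "p * of_bool (x < real_of_int i) + q * (C * real (J - j)) \<le> C + 1 * (C * real (J - j))"
          using pq C yes[of i] by (intro add_mono mult_right_mono) (auto simp: p_def z_def)
        also have "\<dots> = C * real (J + 1 - j)"
          using \<open>j \<le> J\<close> by (simp add: of_nat_diff algebra_simps)
        finally have "ennreal p * of_bool (x < real_of_int i) + ennreal q * ennreal (C * real (J - j)) \<le> ennreal (C * real (J + 1 - j))"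
          using C pq by (auto simp flip: ennreal_plus ennreal_mult split: if_splits)
        moreover have "i - 2 ^ j \<le> l + 2 ^ J - 2 ^ (j + 1) + 1"
          using inv by simp
        ultimately show ?thesis
          unfolding s prod.case if_not_P[OF False] nn_integral_map_spmf nn_integral_return_spmf
          unfolding nn_integral_bool_spmf p_def q_def
          using inv False by (simp add: I_def max_def add.commute)
      qed
    qed (auto simp: I_def s)
  qed
  then show ?thesis
    using i0 unfolding z_def by (simp add: reverse_search_def Let_def nn_integral_map_spmf I_def comp_def)
qed

theorem theorem2:
  fixes n :: nat and F :: cnf and D :: "int \<Rightarrow> bool list set pmf"
    and \<theta> :: real and l :: int
  assumes "n \<ge> 2"
    and "cnf_over n F"
    and "\<And>i. i \<ge> 0 \<Longrightarrow> i_uniform n i (D i)"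
    and "\<theta> > 0"
    and "sat_set n F \<noteq> {}"
    and "0 \<le> l"
    and "real_of_int l \<le> log 2 (real (card (sat_set n F)))"
  shows "measure (measure_spmf (lower_bound n (sat_set n F) D \<theta> l))
           {x. real_of_int x > log 2 (real (card (sat_set n F)))} \<le> \<theta>"
proof -
  define S where "S = sat_set n F"
  define s where "s = log 2 (real (card S))"
  define L where "L = nat \<lceil>log 2 (real n)\<rceil>"
  define C where "C = \<theta> / real L"
  have S: "S \<subseteq> cube n" "S \<noteq> {}"
    using assms(5) by (auto simp: S_def sat_set_def)
  have l: "0 \<le> l" "real_of_int l \<le> s"
    using assms(6,7) by (auto simp: s_def S_def)
  have "1 \<le> log 2 (real n)"
    using assms(1) by simp
  then have L: "L \<ge> 1" "real_of_int \<lceil>log 2 (real n)\<rceil> = real L" "log 2 (real n) \<le> real L"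
    unfolding L_def by linarith+
  have C: "C \<ge> 0" "C * real L = \<theta>"
    using assms(4) L(1) by (auto simp: C_def)
  have "s \<le> real n"
  proof -
    have "real (card S) \<le> 2 ^ n"
      using card_mono[OF finite_cube S(1)] card_cube by (metis of_nat_le_iff of_nat_numeral of_nat_power)
    moreover have "card S > 0"
      using S finite_subset[OF S(1) finite_cube] by (simp add: card_gt_0_iff)
    ultimately show ?thesis
      by (simp add: s_def log_le_iff powr_realpow)
  qed
  have half: "spmf (A1 S D (l + 2 ^ j) 1) True \<le> 1 / 2" if "L \<le> j" for j
  proof (rule spmf_A1_True_le_half)
    have "real n = 2 powr log 2 (real n)"
      using assms(1) by simp
    also have "\<dots> \<le> 2 powr real j"
      using L(3) that by (intro powr_mono) auto
    finally have "real n \<le> 2 ^ j"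
      by (simp add: powr_realpow)
    then show "log 2 (real (card S)) \<le> real_of_int (l + 2 ^ j)"
      using \<open>s \<le> real n\<close> assms(6)
      by (simp only: s_def of_int_add of_int_power of_int_numeral)
  qed (use assms(3) l S in auto)
  have yes: "spmf (A1 S D i (nat \<lceil>8 * ln (real_of_int \<lceil>log 2 (real n)\<rceil> / \<theta>)\<rceil>)) True \<le> C"
    if "s < real_of_int i" for i
    unfolding L(2) C_def
    by (rule spmf_A1_True_le_ratio) (use assms(3,4) l S L(1) that in \<open>auto simp: s_def\<close>)
  have step: "(\<integral>\<^sup>+ x. of_bool (s < real_of_int x) \<partial>measure_spmf (if j = 0 then return_spmf l else
        binary_search S D (l + 2 ^ (j - 1)) (l + 2 ^ j - 1) \<bind> (\<lambda>i.
        reverse_search n S D \<theta> l i \<bind> (\<lambda>i'. return_spmf (max l i'))))) \<le> ennreal (C * real (j - 1))" for j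
  proof (cases j)
    \<comment> \<open>The output \<open>l\<close> is at most \<open>s\<close>, and the bound is
      \<open>0\<close> because \<open>j - 1\<close> truncates.\<close>
    case 0
    then show ?thesis
      using l by (simp add: nn_integral_return_spmf)
  next
    case (Suc k)
    have "1 \<le> (2 :: int) ^ k"
      by simp
    then have "l + 2 ^ (j - 1) \<le> l + 2 ^ j - 1"
      unfolding Suc by simp
    then show ?thesis
      unfolding Suc
      \<comment> \<open>The binary search ends at most at \<open>l + 2 ^ j - 1\<close>, and the
        bound of \<open>reverse_search_le\<close> with \<open>J = j\<close> is uniform over such
        starting points.\<close>
      by (simp only: nn_integral_bind_spmf nn_integral_return_spmf nat.distinct if_False)
        (intro binary_search_le reverse_search_le C l yes, auto)
  qed
  have "ennreal (measure (measure_spmf (lower_bound n S D \<theta> l)) {x. s < real_of_int x})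
      = (\<integral>\<^sup>+ x. of_bool (s < real_of_int x) \<partial>measure_spmf (lower_bound n S D \<theta> l))"
    by (simp add: nn_integral_indicator indicator_def flip: measure_spmf.emeasure_eq_measure nn_integral_indicator)
  also have "\<dots> \<le> (\<integral>\<^sup>+ j. ennreal (C * real (j - 1)) \<partial>measure_spmf (doubling_search S D l))"
    unfolding lower_bound_def nn_integral_bind_spmf[where p="doubling_search S D l"]
    by (intro nn_integral_mono step)
  also have "\<dots> \<le> ennreal \<theta>"
    using doubling_search_le[OF L(1) C(1) half] C(2) by simp
  finally show ?thesis
    using assms(4) by (simp add: s_def S_def)
qed

end
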